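(* Let $n,k,d$ be positive integers with $k\le d<n$. Under the minimum bandwidth (MBR) setting with parameters $n,k,d$, when $d\neq n-1$, there cannot exist any code (linear or non-linear) that performs repair-by-transfer of any node from any $d$ other nodes with a download of $\beta_D=\frac{B}{kd-\binom{k}{2}}$ bits from each of these $d$ nodes, where $B$ is the size in bits of the stored data.
   Context: Distributed storage, MBR setting of the regenerating codes model. Data of size $B$ bits is stored across $n$ nodes, each with a storage capacity of $\alpha$ bits. A code consists of encoding functions $f_i:\{0,1\}^B\to\{0,1\}^\alpha$, $i=1,\dots,n$ (arbitrary functions, not necessarily linear); when the data is $F\in\{0,1\}^B$, node $i$ stores $W_i=f_i(F)$. The following are required of a code in the MBR setting. (1) Data reconstruction: the entire data $F$ can be recovered from the data stored in any $k$ of the $n$ nodes. (2) Node recovery: the data stored in any individual node can be recovered by connecting to any $d$ other nodes and downloading $\beta_D$ bits from each of them. That is, for every node $i$ and every set $\mathcal{D}\subseteq\{1,\dots,n\}\setminus\{i\}$ with $|\mathcal{D}|=d$, each node $j\in\mathcal{D}$ passes to node $i$ a quantity ${}_{\mathcal{D}}S^i_j$ of $\beta_D$ bits that is a function of $W_j$ (the function may depend on $i$, $j$, $\mathcal{D}$), and $W_i$ is determined by $\{{}_{\mathcal{D}}S^i_j\}_{j\in\mathcal{D}}$. (3) $d\beta_D=\alpha$. Recovery is by repair-by-transfer if each of the $d$ nodes helping in the recovery simply passes a part of the data that it stores, without performing any computation: for each $i$, $\mathcal{D}$ and $j\in\mathcal{D}$, the quantity ${}_{\mathcal{D}}S^i_j$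 is the restriction of $W_j$ to a fixed set of $\beta_D$ of the $\alpha$ bit positions stored in node $j$. The amount of data read at each helping node then equals the amount $\beta_D$ downloaded from it. "Repair-by-transfer of any node from any $d$ other nodes" means that this holds for every node $i$ and every set $\mathcal{D}$ of $d$ other nodes.
   Formalization: The formal theorem assumes k ≥ 2 (and B > 0): for k = 1 the claim is false, since then β_D = B/d and storing a full copy of the data at every node, with each of the d helpers passing a different block of B/d bits, performs repair-by-transfer for every n and d. *)

theory Defs
  imports Complex_Main "HOL-Library.FuncSet"
begin

definition bit_strings :: "nat \<Rightarrow> bool list set" where
  "bit_strings m = {w. length w = m}"

definition data_reconstruction ::
  "nat \<Rightarrow> nat \<Rightarrow> nat \<Rightarrow> (nat \<Rightarrow> bool list \<Rightarrow> bool list) \<Rightarrow> bool" where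
  "data_reconstruction n k B f \<longleftrightarrow>
     (\<forall>K \<subseteq> {1..n}. card K = k \<longrightarrow>
        (\<exists>dec. \<forall>F \<in> bit_strings B. dec (\<lambda>i\<in>K. f i F) = F))"

text \<open>
  \<open>S i D j\<close> is the function that helper \<open>j\<close> applies to its stored string when the set \<open>D\<close>
  of helpers repairs node \<open>i\<close>.
\<close>

definition node_recovery ::
  "nat \<Rightarrow> nat \<Rightarrow> nat \<Rightarrow> nat \<Rightarrow> nat \<Rightarrow> (nat \<Rightarrow> bool list \<Rightarrow> bool list) \<Rightarrow>
   (nat \<Rightarrow> nat set \<Rightarrow> nat \<Rightarrow> bool list \<Rightarrow> bool list) \<Rightarrow> bool" where
  "node_recovery n d B \<alpha> \<beta> f S \<longleftrightarrow>
     (\<forall>i \<in> {1..n}. \<forall>D \<subseteq> {1..n} - {i}. card D = d \<longrightarrow>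
        (\<forall>j\<in>D. S i D j \<in> bit_strings \<alpha> \<rightarrow> bit_strings \<beta>) \<and>
        (\<exists>rec. \<forall>F \<in> bit_strings B. rec (\<lambda>j\<in>D. S i D j (f j F)) = f i F))"

definition mbr_code ::
  "nat \<Rightarrow> nat \<Rightarrow> nat \<Rightarrow> nat \<Rightarrow> nat \<Rightarrow> nat \<Rightarrow> (nat \<Rightarrow> bool list \<Rightarrow> bool list) \<Rightarrow>
   (nat \<Rightarrow> nat set \<Rightarrow> nat \<Rightarrow> bool list \<Rightarrow> bool list) \<Rightarrow> bool" where
  "mbr_code n k d B \<alpha> \<beta> f S \<longleftrightarrow>
     (\<forall>i \<in> {1..n}. f i \<in> bit_strings B \<rightarrow> bit_strings \<alpha>) \<and>
     data_reconstruction n k B f \<and>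
     node_recovery n d B \<alpha> \<beta> f S \<and>
     d * \<beta> = \<alpha>"

text \<open>
  \<open>nths w P\<close> lists, in order, the bits of \<open>w\<close> at the positions in \<open>P\<close>; positions are
  counted from \<open>0\<close>.
\<close>

definition repair_by_transfer ::
  "nat \<Rightarrow> nat \<Rightarrow> nat \<Rightarrow> nat \<Rightarrow> (nat \<Rightarrow> nat set \<Rightarrow> nat \<Rightarrow> bool list \<Rightarrow> bool list) \<Rightarrow> bool" where
  "repair_by_transfer n d \<alpha> \<beta> S \<longleftrightarrow>
     (\<forall>i \<in> {1..n}. \<forall>D \<subseteq> {1..n} - {i}. card D = d \<longrightarrow>
        (\<forall>j\<in>D. \<exists>P \<subseteq> {..<\<alpha>}. card P = \<beta> \<and>
           (\<forall>w \<in> bit_strings \<alpha>. S i D j w = nths w P)))"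

text \<open>
  For \<open>k = 1\<close> the required download is \<open>\<beta> = B / d\<close>, and the code that stores a copy of the
  data in every node admits repair-by-transfer, whatever \<open>n\<close> and \<open>d\<close> are: the helper with
  \<open>t\<close> smaller helpers passes the \<open>t\<close>-th of the \<open>d\<close> consecutive blocks of \<open>\<beta>\<close> bits. So the
  impossibility of repair-by-transfer for \<open>d \<noteq> n - 1\<close> can only hold for \<open>k \<ge> 2\<close>.
\<close>

lemma repair_by_transfer_replication:
  fixes n d B \<beta> :: nat
  assumes B: "B = d * \<beta>"
  shows "\<exists>f S. mbr_code n 1 d B B \<beta> f S \<and> repair_by_transfer n d B \<beta> S"
proof -
  define f :: "nat \<Rightarrow> bool list \<Rightarrow> bool list" where "f = (\<lambda>i F. F)"
  define r :: "nat set \<Rightarrow> nat \<Rightarrow> nat" where "r = (\<lambda>D j. card {l\<in>D. l < j})"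
  define P where "P = (\<lambda>D j. {r D j * \<beta>..<r D j * \<beta> + \<beta>})"
  define S :: "nat \<Rightarrow> nat set \<Rightarrow> nat \<Rightarrow> bool list \<Rightarrow> bool list"
    where "S = (\<lambda>i D j w. nths w (P D j))"
  have r_less: "r D j < card D" if "finite D" "j \<in> D" for D j
    unfolding r_def using that by (intro psubset_card_mono) auto
  have r_mono: "r D j < r D l" if "finite D" "j \<in> D" "j < l" for D j l
    unfolding r_def using that by (intro psubset_card_mono) auto
  have r_onto: "r D ` D = {..<card D}" if "finite D" for D
  proof (rule card_subset_eq)
    have "inj_on (r D) D"
      by (rule inj_onI) (metis that r_mono less_irrefl linorder_neqE_nat)
    then show "card (r D ` D) = card {..<card D}" by (simp add: card_image)
  qed (use r_less that in auto)
  have P_sub: "P D j \<subseteq> {..<B}" if "finite D" "j \<in> D" "card D = d" for D j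
  proof -
    have "Suc (r D j) * \<beta> \<le> d * \<beta>"
      using r_less[OF that(1,2)] that(3) by (intro mult_le_mono1) simp
    then show ?thesis by (auto simp: P_def B)
  qed
  have P_card: "card (P D j) = \<beta>" for D j by (simp add: P_def)
  have len: "length (nths w (P D j)) = \<beta>"
    if "finite D" "j \<in> D" "card D = d" "length w = B" for D j w
  proof -
    have "{i. i < length w \<and> i \<in> P D j} = P D j"
      using P_sub[OF that(1-3)] that(4) by auto
    then show ?thesis by (simp add: length_nths P_card)
  qed
  have nths_block: "nths w {a..<a + b} = take b (drop a w)" for w :: "bool list" and a b
    by (simp add: nths_drop lessThan_atLeast0 add.commute flip: nths_upt_eq_take)
  have inj: "F = G"
    if D: "finite D" "card D = d" and FG: "length F = B" "length G = B"
      and eq: "\<And>j. j \<in> D \<Longrightarrow> nths F (P D j) = nths G (P D j)" for D and F G :: "bool list"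
  proof (rule nth_equalityI)
    fix p assume p: "p < length F"
    then have "\<beta> > 0" using B FG by (cases "\<beta> = 0") auto
    then have "p div \<beta> < d" using p FG B by (simp add: less_mult_imp_div_less)
    then have "p div \<beta> \<in> r D ` D" by (simp add: r_onto D)
    then obtain j where j: "j \<in> D" "r D j = p div \<beta>" by auto
    let ?a = "p div \<beta> * \<beta>"
    have 1: "take \<beta> (drop ?a F) ! (p mod \<beta>) = take \<beta> (drop ?a G) ! (p mod \<beta>)"
      using eq[OF j(1)] by (simp only: P_def nths_block j(2))
    have "?a \<le> B" using p FG div_times_less_eq_dividend[of p \<beta>] by linarith
    then have "take \<beta> (drop ?a w) ! (p mod \<beta>) = w ! p" if "length w = B" for w :: "bool list"
      using that p FG \<open>\<beta> > 0\<close> by simp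
    then show "F ! p = G ! p" using 1 FG by simp
  qed (use FG in simp)
  have rec: "\<exists>rec. \<forall>F \<in> bit_strings B. rec (\<lambda>j\<in>D. S i D j (f j F)) = f i F"
    if D: "finite D" "card D = d" for i D
  proof -
    let ?g = "\<lambda>F. \<lambda>j\<in>D. S i D j (f j F)"
    have inj_g: "inj_on ?g (bit_strings B)"
    proof (rule inj_onI)
      fix F G assume FG: "F \<in> bit_strings B" "G \<in> bit_strings B" and g: "?g F = ?g G"
      have "nths F (P D j) = nths G (P D j)" if "j \<in> D" for j
        using fun_cong[OF g, of j] that by (simp add: S_def f_def)
      then show "F = G" using inj[OF D] FG by (simp add: bit_strings_def)
    qed
    show ?thesis
      using inv_into_f_f[OF inj_g] by (intro exI[of _ "inv_into (bit_strings B) ?g"]) (simp add: f_def)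
  qed
  have fin: "finite D" if "D \<subseteq> {1..n} - {i}" for D i
    using that finite_subset by blast
  have "data_reconstruction n 1 B f"
    unfolding data_reconstruction_def
  proof (intro allI impI)
    fix K :: "nat set" assume "card K = 1"
    then obtain i where "K = {i}" by (auto simp: card_1_singleton_iff)
    then show "\<exists>dec. \<forall>F \<in> bit_strings B. dec (\<lambda>i\<in>K. f i F) = F"
      by (intro exI[of _ "\<lambda>g. g i"]) (simp add: f_def)
  qed
  moreover have "node_recovery n d B B \<beta> f S"
    unfolding node_recovery_def
  proof (intro ballI allI impI conjI)
    fix i D assume D: "D \<subseteq> {1..n} - {i}" "card D = d"
    show "\<exists>rec. \<forall>F \<in> bit_strings B. rec (\<lambda>j\<in>D. S i D j (f j F)) = f i F"
      using rec[OF fin[OF D(1)] D(2)] .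
    show "S i D j \<in> bit_strings B \<rightarrow> bit_strings \<beta>" if "j \<in> D" for j
      using len[OF fin[OF D(1)] that D(2)] by (auto simp: S_def bit_strings_def)
  qed
  moreover have "repair_by_transfer n d B \<beta> S"
    unfolding repair_by_transfer_def
  proof (intro ballI allI impI)
    fix i D j assume D: "D \<subseteq> {1..n} - {i}" "card D = d" "j \<in> D"
    show "\<exists>Q \<subseteq> {..<B}. card Q = \<beta> \<and> (\<forall>w \<in> bit_strings B. S i D j w = nths w Q)"
      using P_sub[OF fin[OF D(1)] D(3,2)] P_card by (intro exI[of _ "P D j"]) (simp add: S_def)
  qed
  ultimately have "mbr_code n 1 d B B \<beta> f S \<and> repair_by_transfer n d B \<beta> S"
    by (simp add: mbr_code_def f_def B)
  then show ?thesis by blast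
qed

end

theory Submission
  imports Defs
begin

text \<open>
  Let \<open>N A\<close> be the number of joint contents of the nodes in \<open>A\<close>. Repairing a node with help
  from \<open>A\<close> and \<open>d - card A\<close> further nodes multiplies \<open>N\<close> by at most \<open>2 ^ ((d - card A) * \<beta>)\<close>.
  As \<open>B\<close> equals \<open>\<beta> * (d + (d - 1) + \<dots> + (d - k + 1))\<close>, all these bounds are attained. In
  particular a single node takes \<open>2 ^ (d * \<beta>)\<close> values, so it determines the \<open>d * \<beta>\<close> bits
  that its helpers pass to it. If \<open>n \<ge> d + 2\<close>, a helper \<open>j\<close> has \<open>d + 1\<close> possible targets, and
  since it stores only \<open>d * \<beta>\<close> bits it passes a common bit to two of them, \<open>i\<close> and \<open>i'\<close>.
  This bit is determined by node \<open>i'\<close>, so when \<open>i'\<close> and \<open>j\<close> both help to repair \<open>i\<close>, one bit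
  is superfluous, and \<open>N {i, i'}\<close> falls short of its extremal value.
\<close>

section \<open>Counting values of functions on a finite set, and bit lists\<close>

text \<open>\<open>Z\<close> factors through the pair \<open>(X, Y)\<close>. This is the counting
  form of subadditivity of entropy.\<close>

lemma card_image_le_mult:
  fixes X :: "'a \<Rightarrow> 'b" and Y :: "'a \<Rightarrow> 'c" and Z :: "'a \<Rightarrow> 'd"
  assumes fin: "finite \<Omega>"
    and det: "\<And>u v. u \<in> \<Omega> \<Longrightarrow> v \<in> \<Omega> \<Longrightarrow> X u = X v \<Longrightarrow> Y u = Y v \<Longrightarrow> Z u = Z v"
  shows "card (Z ` \<Omega>) \<le> card (X ` \<Omega>) * card (Y ` \<Omega>)"
proof -
  let ?XY = "\<lambda>u. (X u, Y u)"
  have "Z ` \<Omega> \<subseteq> (Z \<circ> inv_into \<Omega> ?XY) ` (X ` \<Omega> \<times> Y ` \<Omega>)"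
  proof
    fix z assume "z \<in> Z ` \<Omega>"
    then obtain u where u: "u \<in> \<Omega>" "z = Z u" by auto
    let ?v = "inv_into \<Omega> ?XY (?XY u)"
    have "?XY u \<in> ?XY ` \<Omega>" using u by blast
    then have "?v \<in> \<Omega>" "?XY ?v = ?XY u"
      by (rule inv_into_into, rule f_inv_into_f)
    then have "Z u = Z ?v" using det[of u ?v] u by simp
    then show "z \<in> (Z \<circ> inv_into \<Omega> ?XY) ` (X ` \<Omega> \<times> Y ` \<Omega>)"
      using u by (intro image_eqI[of _ _ "?XY u"]) auto
  qed
  then have "card (Z ` \<Omega>) \<le> card (X ` \<Omega> \<times> Y ` \<Omega>)"
    using fin by (intro surj_card_le) auto
  then show ?thesis by (simp add: card_cartesian_product)
qed

text \<open>\<open>Z\<close> factors through \<open>R\<close>, and the induced map from the values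
  of \<open>R\<close> onto those of \<open>Z\<close> is a surjection of finite sets. As its domain
  is no larger than its range, it is injective.\<close>

lemma determined_by_bijective_image:
  assumes fin: "finite \<Omega>"
    and det: "\<And>u v. u \<in> \<Omega> \<Longrightarrow> v \<in> \<Omega> \<Longrightarrow> R u = R v \<Longrightarrow> Z u = Z v"
    and card: "card (R ` \<Omega>) \<le> card (Z ` \<Omega>)"
    and uv: "u \<in> \<Omega>" "v \<in> \<Omega>" "Z u = Z v"
  shows "R u = R v"
proof -
  let ?\<phi> = "Z \<circ> inv_into \<Omega> R"
  have \<phi>: "?\<phi> (R w) = Z w" if "w \<in> \<Omega>" for w
    using det[of "inv_into \<Omega> R (R w)" w] that by (simp add: inv_into_into f_inv_into_f)
  have "?\<phi> ` R ` \<Omega> = Z ` \<Omega>"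
    unfolding image_image using \<phi> by (intro image_cong) auto
  then have "inj_on ?\<phi> (R ` \<Omega>)"
    using fin card card_image_le[of "R ` \<Omega>" ?\<phi>] by (intro eq_card_imp_inj_on) auto
  moreover have "?\<phi> (R u) = ?\<phi> (R v)"
    using \<phi> uv by simp
  ultimately show ?thesis
    using uv by (metis image_eqI inj_onD)
qed

lemma nths_eqI:
  assumes "length v = length w" and "\<And>p. p \<in> P \<Longrightarrow> p < length v \<Longrightarrow> v ! p = w ! p"
  shows "nths v P = nths w P"
proof -
  have "filter (\<lambda>p. snd p \<in> P) (zip v [0..<length v]) =
        filter (\<lambda>p. snd p \<in> P) (zip w [0..<length w])"
    using assms
  \<comment> \<open>Removing the last bit, unlike removing the first, leaves the positions of the
    other bits unchanged.\<close>
  proof (induction v arbitrary: w rule: rev_induct)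
    case (snoc a v)
    then obtain w' b where w: "w = w' @ [b]"
      by (metis append_butlast_last_id length_0_conv snoc_eq_iff_butlast)
    have len: "length w' = length v" using snoc.prems(1) w by simp
    have "v ! p = w' ! p" if "p \<in> P" "p < length v" for p
      using snoc.prems(2)[of p] that w len by (simp add: nth_append)
    moreover have "a = b" if "length v \<in> P"
      using snoc.prems(2)[of "length v"] that w len by (simp add: nth_append)
    ultimately show ?case using snoc.IH[of w'] w len by auto
  qed simp
  then show ?thesis by (simp add: nths_def)
qed

lemma finite_bit_strings [simp]: "finite (bit_strings m)"
  using finite_lists_length_eq[of "UNIV :: bool set" m] by (simp add: bit_strings_def)

lemma card_bit_strings: "card (bit_strings m) = 2 ^ m"
  using card_lists_length_eq[of "UNIV :: bool set" m] by (simp add: bit_strings_def)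

text \<open>Links the denominator of the prescribed download to the sum that arises when nodes are
  added one by one. By \<open>k \<le> d\<close> no difference is truncated.\<close>

lemma sum_diff_eq_binomial:
  assumes "k \<le> d"
  shows "real (\<Sum>m<k. d - m) = real k * real d - real (k choose 2)"
  using assms
proof (induction k)
  case (Suc k)
  have "Suc k choose 2 = k + (k choose 2)"
    by (simp add: numeral_2_eq_2)
  then show ?case using Suc by (simp add: algebra_simps of_nat_diff)
qed simp

section \<open>Upper bounds that repair puts on joint contents\<close>

text \<open>\<open>Q i D l\<close> is the set of positions that helper \<open>l\<close> passes when \<open>D\<close> repairs \<open>i\<close>.\<close>

locale transfer_code =
  fixes n d B \<beta> :: nat
    and f :: "nat \<Rightarrow> bool list \<Rightarrow> bool list"
    and Q :: "nat \<Rightarrow> nat set \<Rightarrow> nat \<Rightarrow> nat set"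
  assumes Q_sub: "\<lbrakk>i \<in> {1..n}; D \<subseteq> {1..n} - {i}; card D = d; l \<in> D\<rbrakk> \<Longrightarrow> Q i D l \<subseteq> {..<d * \<beta>}"
    and Q_card: "\<lbrakk>i \<in> {1..n}; D \<subseteq> {1..n} - {i}; card D = d; l \<in> D\<rbrakk> \<Longrightarrow> card (Q i D l) = \<beta>"
    and repair: "\<lbrakk>i \<in> {1..n}; D \<subseteq> {1..n} - {i}; card D = d;
      F \<in> bit_strings B; G \<in> bit_strings B;
      \<And>l p. l \<in> D \<Longrightarrow> p \<in> Q i D l \<Longrightarrow> f l F ! p = f l G ! p\<rbrakk> \<Longrightarrow> f i F = f i G"
begin

text \<open>The base-2 logarithm of \<open>N A\<close> is the joint Hartley entropy of the nodes in
  \<open>A\<close>. Restricting to \<open>A\<close> makes equality of functions mean agreement on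
  \<open>A\<close>.\<close>

definition N :: "nat set \<Rightarrow> nat" where
  "N A = card ((\<lambda>F. \<lambda>i\<in>A. f i F) ` bit_strings B)"

definition read :: "(nat \<times> nat) set \<Rightarrow> bool list \<Rightarrow> nat \<times> nat \<Rightarrow> bool" where
  "read T F = (\<lambda>(l, p)\<in>T. f l F ! p)"

lemma read_eq_iff: "read T F = read T G \<longleftrightarrow> (\<forall>(l, p)\<in>T. f l F ! p = f l G ! p)"
  by (auto simp: read_def fun_eq_iff restrict_def)

lemma card_read_le:
  assumes "finite T"
  shows "card (read T ` bit_strings B) \<le> 2 ^ card T"
proof -
  have "read T ` bit_strings B \<subseteq> T \<rightarrow>\<^sub>E (UNIV :: bool set)"
    by (auto simp: read_def)
  then have "card (read T ` bit_strings B) \<le> card (T \<rightarrow>\<^sub>E (UNIV :: bool set))"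
    using assms by (intro card_mono finite_PiE) auto
  then show ?thesis using assms by (simp add: card_PiE)
qed

lemma N_singleton: "N {i} = card (f i ` bit_strings B)"
proof -
  have "(\<lambda>F. \<lambda>l\<in>{i}. f l F) ` bit_strings B = (\<lambda>w. \<lambda>l\<in>{i}. w) ` f i ` bit_strings B"
    unfolding image_image by (intro image_cong refl restrict_ext) auto
  moreover have "inj_on (\<lambda>w. \<lambda>l\<in>{i}. w) (f i ` bit_strings B)"
    by (rule inj_onI) (metis restrict_apply' singletonI)
  ultimately show ?thesis unfolding N_def by (simp add: card_image)
qed

lemma N_empty [simp]: "N {} = 1"
proof -
  have "(\<lambda>F. \<lambda>i\<in>{}. f i F) ` bit_strings B = {\<lambda>i. undefined}"
    using card_bit_strings[of B] by (auto simp: image_constant_conv restrict_def)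
  then show ?thesis by (simp add: N_def)
qed

lemma N_insert_le:
  assumes T: "finite T"
    and det: "\<And>F G. \<lbrakk>F \<in> bit_strings B; G \<in> bit_strings B; \<And>l. l \<in> A \<Longrightarrow> f l F = f l G;
      \<And>l p. (l, p) \<in> T \<Longrightarrow> f l F ! p = f l G ! p\<rbrakk> \<Longrightarrow> f i F = f i G"
  shows "N (insert i A) \<le> N A * 2 ^ card T"
proof -
  have "N (insert i A) \<le> N A * card (read T ` bit_strings B)"
    unfolding N_def
  proof (rule card_image_le_mult)
    fix F G
    assume FG: "F \<in> bit_strings B" "G \<in> bit_strings B"
      and A: "(\<lambda>i\<in>A. f i F) = (\<lambda>i\<in>A. f i G)" and T: "read T F = read T G"
    have A': "f l F = f l G" if "l \<in> A" for l
      using fun_cong[OF A, of l] that by simp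
    moreover have "f i F = f i G"
      using det[OF FG A'] T unfolding read_eq_iff by auto
    ultimately show "(\<lambda>i\<in>insert i A. f i F) = (\<lambda>i\<in>insert i A. f i G)"
      by (intro restrict_ext) auto
  qed simp
  also have "\<dots> \<le> N A * 2 ^ card T"
    using card_read_le[OF T] by (rule mult_le_mono2)
  finally show ?thesis .
qed

lemma finite_helpers: "D \<subseteq> {1..n} - {i} \<Longrightarrow> finite D"
  using finite_subset by blast

lemma passed_positions:
  assumes "i \<in> {1..n}" "D \<subseteq> {1..n} - {i}" "card D = d" "E \<subseteq> D"
  shows "finite (SIGMA l:E. Q i D l)" and "card (SIGMA l:E. Q i D l) = card E * \<beta>"
proof -
  have "finite E" using assms finite_helpers finite_subset by metis
  moreover have "finite (Q i D l)" if "l \<in> E" for l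
    using Q_sub[of i D l] assms that finite_subset by blast
  ultimately show "finite (SIGMA l:E. Q i D l)" "card (SIGMA l:E. Q i D l) = card E * \<beta>"
    using Q_card[of i D] assms by (auto simp: card_SigmaI subset_iff)
qed

lemma N_insert_le_repair:
  assumes "A \<subseteq> {1..n}" "l \<in> {1..n} - A" "card A \<le> d" "d < n"
  shows "N (insert l A) \<le> N A * 2 ^ ((d - card A) * \<beta>)"
proof -
  \<comment> \<open>A helper set containing \<open>A\<close> is best: what \<open>A\<close> passes
    is already known, so only \<open>d - card A\<close> helpers contribute new bits.\<close>
  have "\<exists>D. A \<subseteq> D \<and> D \<subseteq> {1..n} - {l} \<and> card D = d"
    using assms by (intro exists_subset_between) auto
  then obtain D where D: "A \<subseteq> D" "D \<subseteq> {1..n} - {l}" "card D = d" by blast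
  let ?T = "SIGMA j:D - A. Q l D j"
  have T: "finite ?T" "card ?T = card (D - A) * \<beta>"
    using passed_positions[of l D "D - A"] assms D by auto
  have "N (insert l A) \<le> N A * 2 ^ card ?T"
  proof (rule N_insert_le[OF T(1)])
    fix F G
    assume FG: "F \<in> bit_strings B" "G \<in> bit_strings B"
      and A: "\<And>l. l \<in> A \<Longrightarrow> f l F = f l G"
      and T: "\<And>j p. (j, p) \<in> ?T \<Longrightarrow> f j F ! p = f j G ! p"
    show "f l F = f l G"
    proof (rule repair[of l D])
      show "f j F ! p = f j G ! p" if "j \<in> D" "p \<in> Q l D j" for j p
        using A[of j] T[of j p] that by (cases "j \<in> A") auto
    qed (use D assms(2) FG in auto)
  qed
  moreover have "card (D - A) = d - card A"
    using D assms by (metis card_Diff_subset finite_atLeastAtMost finite_subset)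
  ultimately show ?thesis using T by simp
qed

text \<open>Adds the nodes of \<open>K - A\<close> one at a time; a node joining \<open>m\<close>
  earlier ones costs a factor of at most \<open>2 ^ ((d - m) * \<beta>)\<close>.\<close>

lemma N_chain:
  assumes "A \<subseteq> K" "K \<subseteq> {1..n}" "card K \<le> d" "d < n"
  shows "N K \<le> N A * 2 ^ (\<beta> * (\<Sum>m=card A..<card K. d - m))"
proof -
  have "finite K" using assms finite_subset by blast
  then have "finite A" using assms finite_subset by blast
  have "N (A \<union> E) \<le> N A * 2 ^ (\<beta> * (\<Sum>m=card A..<card (A \<union> E). d - m))"
    if "finite E" "E \<subseteq> K - A" for E
    using that
  proof (induction E rule: finite_induct)
    case (insert l E)
    have sub: "insert l (A \<union> E) \<subseteq> K" using assms insert by auto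
    have card: "card (insert l (A \<union> E)) = Suc (card (A \<union> E))"
      using insert \<open>finite A\<close> by simp
    have le: "card A \<le> card (A \<union> E)" using insert \<open>finite A\<close> by (intro card_mono) auto
    have "card (insert l (A \<union> E)) \<le> card K"
      using sub \<open>finite K\<close> card_mono by blast
    then have "N (insert l (A \<union> E)) \<le> N (A \<union> E) * 2 ^ ((d - card (A \<union> E)) * \<beta>)"
      using sub assms insert card by (intro N_insert_le_repair) auto
    also have "\<dots> \<le> N A * 2 ^ (\<beta> * (\<Sum>m=card A..<card (A \<union> E). d - m)) *
        2 ^ ((d - card (A \<union> E)) * \<beta>)"
      using insert by (intro mult_le_mono1) auto
    also have "\<dots> = N A * 2 ^ (\<beta> * (\<Sum>m=card A..<card (insert l (A \<union> E)). d - m))"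
      using le by (simp add: card power_add algebra_simps)
    finally show ?case by simp
  qed simp
  from this[of "K - A"] show ?thesis
    using assms \<open>finite K\<close> by (simp add: Un_absorb1)
qed

end

section \<open>Lower bounds from reconstruction, and the contradiction\<close>

text \<open>Collects the properties of a supposed counterexample, with the data size equal to the
  upper bound that \<open>N_chain\<close> gives for \<open>k\<close> nodes.\<close>

locale extremal_transfer_code = transfer_code +
  fixes k :: nat
  assumes k: "2 \<le> k" "k \<le> d" and n: "d + 2 \<le> n" and \<beta>: "0 < \<beta>"
    and reconstruct: "\<lbrakk>K \<subseteq> {1..n}; card K = k; F \<in> bit_strings B; G \<in> bit_strings B;
      \<And>i. i \<in> K \<Longrightarrow> f i F = f i G\<rbrakk> \<Longrightarrow> F = G"
    and B: "B = \<beta> * (\<Sum>m<k. d - m)"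
begin

text \<open>Extend \<open>A\<close> to \<open>k\<close> nodes, which take \<open>2 ^ B\<close> joint
  values by reconstruction. The added nodes account for at most the tail of the sum in
  \<open>B\<close>, so \<open>A\<close> must account for its head.\<close>

lemma N_ge:
  assumes "A \<subseteq> {1..n}" "card A \<le> k"
  shows "2 ^ (\<beta> * (\<Sum>m<card A. d - m)) \<le> N A"
proof -
  have "\<exists>K. A \<subseteq> K \<and> K \<subseteq> {1..n} \<and> card K = k"
    using assms k n by (intro exists_subset_between) auto
  then obtain K where K: "A \<subseteq> K" "K \<subseteq> {1..n}" "card K = k" by blast
  have "inj_on (\<lambda>F. \<lambda>i\<in>K. f i F) (bit_strings B)"
  proof (rule inj_onI)
    fix F G
    assume FG: "F \<in> bit_strings B" "G \<in> bit_strings B"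
      and eq: "(\<lambda>i\<in>K. f i F) = (\<lambda>i\<in>K. f i G)"
    have "f i F = f i G" if "i \<in> K" for i
      using fun_cong[OF eq, of i] that by simp
    then show "F = G" using reconstruct[OF K(2,3) FG] by simp
  qed
  then have "N K = 2 ^ B" unfolding N_def by (simp add: card_image card_bit_strings)
  moreover have "(\<Sum>m<k. d - m) = (\<Sum>m<card A. d - m) + (\<Sum>m=card A..<k. d - m)"
    using assms(2) by (simp add: lessThan_atLeast0 sum.atLeastLessThan_concat)
  ultimately have "2 ^ (\<beta> * (\<Sum>m<card A. d - m)) * 2 ^ (\<beta> * (\<Sum>m=card A..<k. d - m)) = N K"
    by (simp add: B power_add algebra_simps)
  also have "\<dots> \<le> N A * 2 ^ (\<beta> * (\<Sum>m=card A..<k. d - m))"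
    using N_chain[of A K] K k n by simp
  finally show ?thesis by simp
qed

text \<open>The \<open>d * \<beta>\<close> passed bits determine node \<open>i\<close>, which by
  \<open>N_ge\<close> takes at least as many values as they can. Hence the dependence is bijective
  and can be inverted.\<close>

lemma passed_bit_determined:
  assumes i: "i \<in> {1..n}" and D: "D \<subseteq> {1..n} - {i}" "card D = d"
    and j: "j \<in> D" "x \<in> Q i D j"
    and FG: "F \<in> bit_strings B" "G \<in> bit_strings B" "f i F = f i G"
  shows "f j F ! x = f j G ! x"
proof -
  let ?T = "SIGMA l:D. Q i D l"
  have T: "finite ?T" "card ?T = d * \<beta>"
    using passed_positions[OF i D order_refl] D by auto
  have "card (read ?T ` bit_strings B) \<le> 2 ^ (d * \<beta>)"
    using card_read_le[OF T(1)] T(2) by simp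
  also have "\<dots> \<le> card (f i ` bit_strings B)"
    using N_ge[of "{i}"] i k by (simp add: N_singleton mult.commute)
  finally have "read ?T F = read ?T G"
    using i D FG
    by (intro determined_by_bijective_image[where Z = "f i" and R = "read ?T"])
       (auto intro!: repair[of i D] simp: read_eq_iff)
  then show ?thesis using j by (auto simp: read_eq_iff)
qed

lemma helpers_pass_disjoint_bits:
  assumes i: "i \<in> {1..n}" and D: "D \<subseteq> {1..n} - {i}" "card D = d"
    and i': "i' \<in> {1..n}" and D': "D' \<subseteq> {1..n} - {i'}" "card D' = d"
    and j: "j \<in> D" "j \<in> D'" and "i' \<in> D"
  shows "Q i D j \<inter> Q i' D' j = {}"
proof (rule ccontr)
  assume "Q i D j \<inter> Q i' D' j \<noteq> {}"
  then obtain x where x: "x \<in> Q i D j" "x \<in> Q i' D' j" by blast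
  have ne: "j \<noteq> i'" "i \<noteq> i'" using j D D' \<open>i' \<in> D\<close> by auto
  let ?T = "SIGMA l:D - {i'}. Q i D l"
  have "card (D - {i'}) = d - 1" using \<open>i' \<in> D\<close> D by simp
  then have T: "finite ?T" "card ?T = (d - 1) * \<beta>" "(j, x) \<in> ?T"
    using passed_positions[of i D "D - {i'}"] i D j x ne by auto
  \<comment> \<open>Given node \<open>i'\<close>, both its own share of the repair of
    \<open>i\<close> and bit \<open>x\<close> of node \<open>j\<close> are known.\<close>
  have "N {i, i'} \<le> N {i'} * 2 ^ card (?T - {(j, x)})"
  proof (rule N_insert_le)
    fix F G
    assume FG: "F \<in> bit_strings B" "G \<in> bit_strings B"
      and eq: "\<And>l. l \<in> {i'} \<Longrightarrow> f l F = f l G"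
      and T: "\<And>l p. (l, p) \<in> ?T - {(j, x)} \<Longrightarrow> f l F ! p = f l G ! p"
    have "f j F ! x = f j G ! x"
      using passed_bit_determined[OF i' D' j(2) x(2) FG] eq by simp
    then have "f l F ! p = f l G ! p" if "l \<in> D" "p \<in> Q i D l" for l p
      using that T[of l p] eq by (cases "l = i'") auto
    then show "f i F = f i G" using repair[OF i D FG] by simp
  qed (use T in simp)
  also have "\<dots> = N {i'} * 2 ^ ((d - 1) * \<beta> - 1)"
    using T by simp
  also have "\<dots> \<le> 2 ^ (d * \<beta>) * 2 ^ ((d - 1) * \<beta> - 1)"
    using N_insert_le_repair[of "{}" i'] i' n by (intro mult_le_mono1) simp
  \<comment> \<open>Strict because \<open>d \<ge> 2\<close> and \<open>\<beta> > 0\<close> make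
    \<open>(d - 1) * \<beta>\<close> positive, so subtracting 1 really lowers the exponent.\<close>
  also have "\<dots> < 2 ^ (d * \<beta>) * 2 ^ ((d - 1) * \<beta>)"
    using k \<beta> by simp
  also have "\<dots> = 2 ^ (\<beta> * (\<Sum>m<card {i, i'}. d - m))"
    using ne by (simp add: numeral_2_eq_2 power_add algebra_simps)
  also have "\<dots> \<le> N {i, i'}"
    using i i' ne k by (intro N_ge) auto
  finally show False by simp
qed

lemma inconsistent: False
proof -
  \<comment> \<open>The common helper is \<open>d + 2\<close>. Each target \<open>i\<close> in
    \<open>{1..d + 1}\<close> must leave out one of the \<open>d\<close> other targets to have
    exactly \<open>d\<close> helpers; it omits its cyclic successor \<open>s i\<close>.\<close>
  define s where "s i = (if i \<le> d then Suc i else 1)" for i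
  define D where "D i = insert (d + 2) ({1..d + 1} - {i, s i})" for i
  have D: "D i \<subseteq> {1..n} - {i}" "card (D i) = d" if "i \<in> {1..d + 1}" for i
  proof -
    have "s i \<in> {1..d + 1}" "s i \<noteq> i" using that k by (auto simp: s_def)
    then have "card ({1..d + 1} - {i, s i}) = d - 1"
      using that by (subst card_Diff_subset) auto
    then show "card (D i) = d" using k by (simp add: D_def)
    show "D i \<subseteq> {1..n} - {i}" using that n by (auto simp: D_def)
  qed
  have mem: "d + 2 \<in> D i" for i by (simp add: D_def)
  let ?P = "\<lambda>i. Q i (D i) (d + 2)"
  have sub: "?P i \<subseteq> {..<d * \<beta>}" and card: "card (?P i) = \<beta>" if "i \<in> {1..d + 1}" for i
    using Q_sub[of i "D i"] Q_card[of i "D i"] D[OF that] that n mem by auto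
  have disj: "?P i \<inter> ?P i' = {}" if ii: "i \<in> {1..d + 1}" "i' \<in> {1..d + 1}" "i \<noteq> i'" for i i'
  proof -
    \<comment> \<open>The cycle has length \<open>d + 1 \<ge> 3\<close>, so two targets never omit
      each other and one of them helps the other.\<close>
    have "s i \<noteq> i' \<or> s i' \<noteq> i"
      using ii k by (auto simp: s_def split: if_splits)
    then consider "i' \<in> D i" | "i \<in> D i'" using ii by (auto simp: D_def)
    then show ?thesis
    proof cases
      case 1
      then show ?thesis
        using ii n mem D by (intro helpers_pass_disjoint_bits) auto
    next
      case 2
      then have "?P i' \<inter> ?P i = {}"
        using ii n mem D by (intro helpers_pass_disjoint_bits) auto
      then show ?thesis by (simp add: Int_commute)
    qed
  qed
  \<comment> \<open>Pigeonhole: \<open>d + 1\<close> disjoint blocks of \<open>\<beta>\<close>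
    positions do not fit into the \<open>d * \<beta>\<close> positions of the helper.\<close>
  have "(d + 1) * \<beta> = (\<Sum>i\<in>{1..d + 1}. card (?P i))"
    using card by simp
  also have "\<dots> = card (\<Union>i\<in>{1..d + 1}. ?P i)"
    using sub disj finite_subset[OF sub] by (intro card_UN_disjoint[symmetric]) auto
  also have "\<dots> \<le> card {..<d * \<beta>}"
    using sub by (intro card_mono UN_least) auto
  finally show False using \<beta> by simp
qed

end

section \<open>Reduction of the theorem to the extremal code\<close>

theorem theorem1:
  fixes n k d B \<alpha> \<beta> :: nat
  assumes "2 \<le> k" and "k \<le> d" and "d < n" and "d \<noteq> n - 1"
    and "0 < B"
    and "real \<beta> = real B / (real k * real d - real (k choose 2))"
  shows "\<not> (\<exists>f S. mbr_code n k d B \<alpha> \<beta> f S \<and> repair_by_transfer n d \<alpha> \<beta> S)"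
proof
  assume "\<exists>f S. mbr_code n k d B \<alpha> \<beta> f S \<and> repair_by_transfer n d \<alpha> \<beta> S"
  then obtain f S where code: "mbr_code n k d B \<alpha> \<beta> f S"
    and transfer: "repair_by_transfer n d \<alpha> \<beta> S" by blast
  have \<alpha>: "\<alpha> = d * \<beta>" using code by (simp add: mbr_code_def)
  have f: "f i F \<in> bit_strings \<alpha>" if "i \<in> {1..n}" "F \<in> bit_strings B" for i F
    using code that by (auto simp: mbr_code_def)
  define Q where
    "Q i D j = (SOME P. P \<subseteq> {..<\<alpha>} \<and> card P = \<beta> \<and> (\<forall>w \<in> bit_strings \<alpha>. S i D j w = nths w P))"
    for i D j
  have Q: "Q i D j \<subseteq> {..<\<alpha>} \<and> card (Q i D j) = \<beta> \<and>
      (\<forall>w \<in> bit_strings \<alpha>. S i D j w = nths w (Q i D j))"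
    if "i \<in> {1..n}" "D \<subseteq> {1..n} - {i}" "card D = d" "j \<in> D" for i D j
    unfolding Q_def
    by (rule someI_ex) (use transfer that in \<open>auto simp: repair_by_transfer_def\<close>)
  let ?s = "\<Sum>m<k. d - m"
  \<comment> \<open>The term for \<open>m = 0\<close> makes the sum positive, so the division
    defining \<open>\<beta>\<close> can be undone.\<close>
  have "d - 0 \<le> ?s" using assms by (intro member_le_sum) auto
  then have pos: "real ?s > 0" using assms by (simp del: of_nat_sum)
  have \<beta>: "real \<beta> = real B / real ?s"
    using assms(6) sum_diff_eq_binomial[OF assms(2)] by simp
  then have "real B = real (\<beta> * ?s)"
    using pos unfolding of_nat_mult by (metis nonzero_eq_divide_eq order_less_irrefl)
  then have B: "B = \<beta> * ?s" by (simp only: of_nat_eq_iff)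
  interpret extremal_transfer_code n d B \<beta> f Q k
  proof
    fix i D l assume *: "i \<in> {1..n}" "D \<subseteq> {1..n} - {i}" "card D = d" "l \<in> D"
    show "Q i D l \<subseteq> {..<d * \<beta>}" "card (Q i D l) = \<beta>" using Q[OF *] \<alpha> by auto
  next
    fix i D F G
    assume i: "i \<in> {1..n}" "D \<subseteq> {1..n} - {i}" "card D = d"
      and FG: "F \<in> bit_strings B" "G \<in> bit_strings B"
      and eq: "\<And>l p. l \<in> D \<Longrightarrow> p \<in> Q i D l \<Longrightarrow> f l F ! p = f l G ! p"
    obtain rec where rec: "\<And>F. F \<in> bit_strings B \<Longrightarrow> rec (\<lambda>j\<in>D. S i D j (f j F)) = f i F"
      using code i unfolding mbr_code_def node_recovery_def by metis
    have "S i D j (f j F) = S i D j (f j G)" if "j \<in> D" for j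
    proof -
      have "f j F \<in> bit_strings \<alpha>" "f j G \<in> bit_strings \<alpha>" using f FG i that by auto
      then show ?thesis
        using Q[OF i that] eq[OF that] by (auto intro!: nths_eqI simp: bit_strings_def)
    qed
    then have "(\<lambda>j\<in>D. S i D j (f j F)) = (\<lambda>j\<in>D. S i D j (f j G))"
      by (intro restrict_ext)
    then show "f i F = f i G" using rec FG by metis
  next
    fix K F G
    assume K: "K \<subseteq> {1..n}" "card K = k" and FG: "F \<in> bit_strings B" "G \<in> bit_strings B"
      and eq: "\<And>i. i \<in> K \<Longrightarrow> f i F = f i G"
    obtain dec where dec: "\<And>F. F \<in> bit_strings B \<Longrightarrow> dec (\<lambda>i\<in>K. f i F) = F"
      using code K unfolding mbr_code_def data_reconstruction_def by metis
    have "(\<lambda>i\<in>K. f i F) = (\<lambda>i\<in>K. f i G)" using eq by (intro restrict_ext)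
    then show "F = G" using dec FG by metis
  next
    show "0 < \<beta>" using B assms(5) by (intro gr0I) simp
  qed (use assms B in auto)
  show False by (rule inconsistent)
qed

end
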